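(* For every graph $G$, $$\kappa(G\times K_2)=\min\{2\kappa(G),\,b(G)\}.$$
   Context: All graphs are finite, undirected, without loops or multiple edges (and have at least one vertex). The connectivity $\kappa(G)$ of a graph $G$ is the fewest number of vertices whose removal from $G$ results in a disconnected or trivial (one-vertex) graph. $K_2$ is the complete graph on two vertices. The Kronecker (direct) product $G_1\times G_2$ of graphs $G_1,G_2$ has vertex set $V(G_1)\times V(G_2)$, with $(u_1,v_1)$ and $(u_2,v_2)$ adjacent if and only if $u_1u_2\in E(G_1)$ and $v_1v_2\in E(G_2)$. For $W\subseteq V(G)$, $G[W]$ is the subgraph induced by $W$ and $G-W$ is the graph obtained by deleting the vertices of $W$. A one-vertex graph counts as bipartite. Let $X,Y\subseteq V(G)$ be two disjoint sets (possibly empty) with $V(G)-(X\cup Y)\neq\emptyset$. The ordered pair $(X,Y)$ is called a b-pair of $G$ if $G-(X\cup Y)$ has a bipartite connected component $C$ such that $G[V(C)\cup\{x\}]$ is also bipartite for each $x\in X$. Define $b(G)=\min\{|X|+2|Y| : (X,Y)\text{ is a b-pair of }G\}$. *)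

theory Defs
  imports "Graph_Theory.Kuratowski"
begin

text \<open>
  Simple graphs are the symmetric digraphs of locale \<^locale>\<open>graph\<close> (finite, no loops, no parallel
  arcs): an edge is a pair of opposite arcs. That locale admits the null graph, which is excluded
  here, so theorems about a graph \<open>G\<close> additionally assume \<open>verts G \<noteq> {}\<close>.
\<close>

definition delete_verts :: "('a, 'b) pre_digraph \<Rightarrow> 'a set \<Rightarrow> ('a, 'b) pre_digraph" where
  "delete_verts G W = G \<restriction> (verts G - W)"

text \<open>
  Arcs are pairs of arcs: an arc from \<open>u\<^sub>1\<close> to \<open>u\<^sub>2\<close> and one from \<open>v\<^sub>1\<close> to \<open>v\<^sub>2\<close> give one from
  \<open>(u\<^sub>1, v\<^sub>1)\<close> to \<open>(u\<^sub>2, v\<^sub>2)\<close>; see \<open>arcs_ends_kronecker_product\<close> below for the adjacency relation.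
\<close>

definition kronecker_product ::
    "('a, 'b) pre_digraph \<Rightarrow> ('c, 'd) pre_digraph \<Rightarrow> ('a \<times> 'c, 'b \<times> 'd) pre_digraph" where
  "kronecker_product G H =
    \<lparr> verts = verts G \<times> verts H, arcs = arcs G \<times> arcs H,
      tail = map_prod (tail G) (tail H), head = map_prod (head G) (head H) \<rparr>"

text \<open>
  Only proper subsets may be removed, so that at least one vertex remains: the library's
  \<^const>\<open>Digraph_Component.connected\<close> is false for the null graph.
\<close>

definition vertex_connectivity :: "('a, 'b) pre_digraph \<Rightarrow> nat" where
  "vertex_connectivity G =
    Min {card S | S. S \<subset> verts G \<and>
      (\<not> Digraph_Component.connected (delete_verts G S) \<or> card (verts (delete_verts G S)) = 1)}"

text \<open>A colour class may be empty, so a one-vertex graph is bipartite.\<close>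

definition bipartite :: "('a, 'b) pre_digraph \<Rightarrow> bool" where
  "bipartite G \<longleftrightarrow> (\<exists>A B. verts G = A \<union> B \<and> A \<inter> B = {} \<and>
    (\<forall>(u, v) \<in> arcs_ends G. u \<in> A \<and> v \<in> B \<or> u \<in> B \<and> v \<in> A))"

definition connected_component :: "('a, 'b) pre_digraph \<Rightarrow> ('a, 'b) pre_digraph \<Rightarrow> bool" where
  "connected_component G C \<longleftrightarrow> pre_digraph.max_subgraph G Digraph_Component.connected C"

definition b_pair :: "('a, 'b) pre_digraph \<Rightarrow> 'a set \<Rightarrow> 'a set \<Rightarrow> bool" where
  "b_pair G X Y \<longleftrightarrow>
    X \<subseteq> verts G \<and> Y \<subseteq> verts G \<and> X \<inter> Y = {} \<and> verts G - (X \<union> Y) \<noteq> {} \<and>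
    (\<exists>C. connected_component (delete_verts G (X \<union> Y)) C \<and> bipartite C \<and>
      (\<forall>x\<in>X. bipartite (G \<restriction> (verts C \<union> {x}))))"

definition b_number :: "('a, 'b) pre_digraph \<Rightarrow> nat" where
  "b_number G = Min {card X + 2 * card Y | X Y. b_pair G X Y}"

lemma arcs_ends_kronecker_product:
  "((u1, v1), (u2, v2)) \<in> arcs_ends (kronecker_product G H) \<longleftrightarrow>
    (u1, u2) \<in> arcs_ends G \<and> (v1, v2) \<in> arcs_ends H"
  by (force simp: arcs_ends_conv kronecker_product_def)

lemma graph_kronecker_product:
  assumes "graph G" and "graph H"
  shows "graph (kronecker_product G H)"
proof -
  interpret G: graph G by fact
  interpret H: graph H by fact
  have "symmetric (kronecker_product G H)"
    using G.sym_arcs H.sym_arcs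
    by (auto simp: symmetric_def sym_def arcs_ends_kronecker_product)
  then show ?thesis
    by unfold_locales
      (auto simp: kronecker_product_def arc_to_ends_def
        dest: G.no_loops H.no_loops intro: G.no_multi_arcs H.no_multi_arcs)
qed

text \<open>The minima defining the two invariants are taken over finite nonempty sets.\<close>

lemma vertex_connectivity_wf:
  assumes "finite (verts G)" and "verts G \<noteq> {}"
  defines "M \<equiv> {card S | S. S \<subset> verts G \<and>
      (\<not> Digraph_Component.connected (delete_verts G S) \<or> card (verts (delete_verts G S)) = 1)}"
  shows "finite M" and "M \<noteq> {}"
proof -
  have "M \<subseteq> card ` Pow (verts G)" unfolding M_def by auto
  then show "finite M" using assms(1) by (auto intro: finite_subset)
  obtain v where v: "v \<in> verts G" using assms(2) by auto
  have "card (verts (delete_verts G (verts G - {v}))) = 1"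
    using v by (simp add: delete_verts_def double_diff)
  moreover have "verts G - {v} \<subset> verts G" using v by auto
  ultimately show "M \<noteq> {}" unfolding M_def by blast
qed

lemma b_number_wf:
  assumes "graph G" and "verts G \<noteq> {}"
  defines "M \<equiv> {card X + 2 * card Y | X Y. b_pair G X Y}"
  shows "finite M" and "M \<noteq> {}"
proof -
  interpret graph G by fact
  have "M \<subseteq> (\<lambda>(X, Y). card X + 2 * card Y) ` (Pow (verts G) \<times> Pow (verts G))"
    unfolding M_def b_pair_def by auto
  then show "finite M" by (rule finite_subset) auto
  obtain v where v: "v \<in> verts G" using assms(2) by auto
  define C where "C = G \<restriction> {v}"
  have del: "delete_verts G ({} \<union> (verts G - {v})) = C"
    using v by (simp add: delete_verts_def C_def double_diff)
  have arcs: "arcs C = {}" unfolding C_def using no_loops by fastforce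
  have vs: "verts C = {v}" by (simp add: C_def)
  have wf: "wf_digraph C" unfolding C_def by (rule wellformed_induce_subgraph)
  have "Digraph_Component.connected C"
    by (auto simp: connected_conv vs arcs_ends_conv arcs)
  moreover have "subgraph C C" using wf by (simp add: subgraph_def compatible_def)
  ultimately have "connected_component C C"
    unfolding connected_component_def pre_digraph.max_subgraph_def
    by (auto simp: subgraph_def compatible_def intro!: pre_digraph.equality)
  moreover have "bipartite C"
    unfolding bipartite_def
    by (rule exI[of _ "{v}"], rule exI[of _ "{}"]) (simp add: vs arcs arcs_ends_conv)
  ultimately have "b_pair G {} (verts G - {v})"
    unfolding b_pair_def del using v by auto
  then show "M \<noteq> {}" unfolding M_def by blast
qed

end

theory Submission
  imports Defs
begin

text \<open>
  If \<open>S\<close> separates \<open>G\<close>, both copies of \<open>S\<close> separate \<open>G \<times> K\<^sub>2\<close>. If \<open>(X, Y)\<close> is a b-pair with bipartite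
  component \<open>T\<close>, the first copy of one colour class together with the second copy of the other is cut
  off by both copies of \<open>Y\<close> and one copy of each \<open>x \<in> X\<close>, since the neighbours of \<open>x\<close> in \<open>T\<close> all have
  the same colour.

  Conversely, let \<open>S\<close> split \<open>G \<times> K\<^sub>2\<close> into \<open>D\<close> and the rest. Let \<open>X\<close>, \<open>Y\<close> and \<open>Z\<close> be the sets of
  vertices of \<open>G\<close> with exactly one, two and no copies in \<open>S\<close>, so that \<open>card S = card X + 2 * card Y\<close>.
  If some vertex of \<open>Z\<close> has its two copies on different sides, then the vertices of \<open>Z\<close> with this
  property are properly coloured by the side of their first copy, and \<open>(X, Y)\<close> is a b-pair. Otherwise,
  if some vertex has no neighbour in \<open>Z\<close>, its degree bounds \<open>b(G)\<close> and is at most \<open>card (X \<union> Y)\<close>.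
  Otherwise \<open>Z\<close> meets both sides; if \<open>X\<^sub>1\<close> and \<open>X\<^sub>2\<close> are the parts of \<open>X\<close> with remaining copy on either
  side, \<open>X\<^sub>1 \<union> Y\<close> and \<open>X\<^sub>2 \<union> Y\<close> both separate \<open>G\<close>, whence \<open>2 * \<kappa>(G) \<le> card S\<close>.
\<close>

section \<open>Connectedness through vertex sets closed under adjacency\<close>

lemma arcs_ends_induce_subgraph_iff:
  "(u, v) \<in> arcs_ends (G \<restriction> W) \<longleftrightarrow> (u, v) \<in> arcs_ends G \<and> u \<in> W \<and> v \<in> W"
  by (auto simp: arcs_ends_conv)

lemma verts_delete_verts [simp]: "verts (delete_verts G W) = verts G - W"
  by (simp add: delete_verts_def)

text \<open>Induction along a path from \<open>u\<close>: no arc leaves \<open>A\<close>.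
  Connectedness enters the later arguments through such closed sets instead of paths.\<close>

lemma connected_adj_closed_subset:
  assumes "Digraph_Component.connected G" and "u \<in> verts G" and "u \<in> A"
    and closed: "\<And>x y. (x, y) \<in> arcs_ends G \<Longrightarrow> x \<in> A \<longleftrightarrow> y \<in> A"
  shows "verts G \<subseteq> A"
proof
  fix v assume "v \<in> verts G"
  then have "(u, v) \<in> rtrancl_on (verts G) ((arcs_ends G)\<^sup>s)"
    using assms(1,2) by (auto simp: connected_conv)
  then show "v \<in> A"
  proof (induction rule: rtrancl_on_induct)
    case base
    then show ?case using assms(3) by blast
  next
    case (step x y)
    then show ?case using closed by (auto simp: symcl_def)
  qed
qed

text \<open>For the converse, the vertices joined to \<open>u\<close> by a path form a closed set,
  so they exhaust the graph.\<close>

lemma (in wf_digraph) connected_iff_adj_closed: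
  "Digraph_Component.connected G \<longleftrightarrow> verts G \<noteq> {} \<and>
    (\<forall>A. verts G \<inter> A \<noteq> {} \<and> (\<forall>x y. (x, y) \<in> arcs_ends G \<longrightarrow> (x \<in> A \<longleftrightarrow> y \<in> A)) \<longrightarrow> verts G \<subseteq> A)"
  (is "?L \<longleftrightarrow> ?R")
proof
  assume ?L
  then have "verts G \<subseteq> A"
    if "verts G \<inter> A \<noteq> {}" "\<forall>x y. (x, y) \<in> arcs_ends G \<longrightarrow> (x \<in> A \<longleftrightarrow> y \<in> A)" for A
    using that connected_adj_closed_subset[of G _ A] by auto
  moreover have "verts G \<noteq> {}" using \<open>?L\<close> by (simp add: connected_conv)
  ultimately show ?R by simp
next
  assume R: ?R
  have "(u, v) \<in> rtrancl_on (verts G) ((arcs_ends G)\<^sup>s)" if u: "u \<in> verts G" and v: "v \<in> verts G" for u v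
  proof -
    let ?A = "{w. (u, w) \<in> rtrancl_on (verts G) ((arcs_ends G)\<^sup>s)}"
    have "x \<in> ?A \<longleftrightarrow> y \<in> ?A" if "(x, y) \<in> arcs_ends G" for x y
      using that by (auto simp: symcl_def dest: adj_in_verts intro: rtrancl_on_into_rtrancl_on)
    moreover have "u \<in> ?A" using u by simp
    ultimately have "verts G \<subseteq> ?A" using R u by blast
    then show ?thesis using v by blast
  qed
  then show ?L using R by (simp add: connected_conv)
qed

text \<open>By maximality: adding both ends of an arc that meets \<open>C\<close> gives a connected
  subgraph containing \<open>C\<close>, hence \<open>C\<close> itself, with that arc.\<close>

lemma connected_component_adj:
  assumes "wf_digraph G" and "connected_component G C" and uv: "(u, v) \<in> arcs_ends G"
  shows "u \<in> verts C \<longleftrightarrow> v \<in> verts C"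
    and "u \<in> verts C \<Longrightarrow> (u, v) \<in> arcs_ends C"
proof -
  interpret wf_digraph G by fact
  have sub: "subgraph C G" and conn: "Digraph_Component.connected C"
    and max: "\<And>H. subgraph C H \<Longrightarrow> subgraph H G \<Longrightarrow> Digraph_Component.connected H \<Longrightarrow> H = C"
    using assms(2) by (auto simp: connected_component_def max_subgraph_def)
  have *: "C = G \<restriction> (verts C \<union> {u, v})" if "u \<in> verts C \<or> v \<in> verts C"
  proof (rule max[symmetric])
    let ?H = "G \<restriction> (verts C \<union> {u, v})"
    interpret H: wf_digraph ?H ..
    have W: "verts C \<union> {u, v} \<subseteq> verts G" using sub adj_in_verts[OF uv] by blast
    then show "subgraph ?H G" by (rule subgraph_induce_subgraphI)
    have "subgraph C (G \<restriction> verts C)" using sub by (rule subgraph_induce_subgraphI2)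
    then show CH: "subgraph C ?H" by (auto simp: subgraph_def compatible_def)
    show "Digraph_Component.connected ?H"
      unfolding H.connected_iff_adj_closed
    proof (intro conjI allI impI)
      fix A assume A: "verts ?H \<inter> A \<noteq> {} \<and> (\<forall>x y. (x, y) \<in> arcs_ends ?H \<longrightarrow> (x \<in> A \<longleftrightarrow> y \<in> A))"
      have "u \<in> A \<longleftrightarrow> v \<in> A" using A uv by (auto simp: arcs_ends_induce_subgraph_iff)
      \<comment> \<open>If \<open>A\<close> meets \<open>?H\<close> only in \<open>u\<close> or
        \<open>v\<close>, it contains both of them, and one of them lies in
        \<open>C\<close>.\<close>
      with A that obtain w where "w \<in> verts C" "w \<in> A" by auto
      moreover have "x \<in> A \<longleftrightarrow> y \<in> A" if "(x, y) \<in> arcs_ends C" for x y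
        using that A arcs_ends_mono[OF CH] by blast
      ultimately have "verts C \<subseteq> A" using conn by (rule_tac connected_adj_closed_subset)
      then show "verts ?H \<subseteq> A" using that \<open>u \<in> A \<longleftrightarrow> v \<in> A\<close> by auto
    qed simp
  qed
  then have **: "verts C = verts C \<union> {u, v}" if "u \<in> verts C \<or> v \<in> verts C"
    using that by (metis induce_subgraph_verts)
  then show "u \<in> verts C \<longleftrightarrow> v \<in> verts C" by blast
  show "(u, v) \<in> arcs_ends C" if "u \<in> verts C"
    using * that uv by (metis UnCI arcs_ends_induce_subgraph_iff insertCI)
qed

text \<open>The vertices reachable from \<open>z\<close> induce a strongly connected subgraph. By
  symmetry they form a closed set, so no larger connected subgraph contains it.\<close>

lemma (in sym_digraph) connected_component_exists:
  assumes "z \<in> verts G"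
  obtains C where "connected_component G C" and "z \<in> verts C"
proof
  let ?R = "{v. z \<rightarrow>\<^sup>* v}" and ?C = "G \<restriction> {v. z \<rightarrow>\<^sup>* v}"
  interpret C: wf_digraph ?C ..
  have scc: "induced_subgraph ?C G" "strongly_connected ?C"
    using induce_reachable_is_in_sccs[OF assms] by (auto simp: sccs_def)
  then have sub: "subgraph ?C G" by (rule_tac induced_imp_subgraph)
  have conn: "Digraph_Component.connected ?C"
    using scc(2) by (auto intro!: C.connectedI C.reachable_mk_symmetricI simp: strongly_connected_def)
  have "H = ?C" if CH: "subgraph ?C H" and HG: "subgraph H G" and H: "Digraph_Component.connected H" for H
  proof -
    have "verts H \<subseteq> ?R"
    proof (rule connected_adj_closed_subset[OF H])
      show "z \<in> verts H" "z \<in> ?R" using CH assms by (auto simp: subgraph_def)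
      fix x y assume "(x, y) \<in> arcs_ends H"
      then have "x \<rightarrow> y" using arcs_ends_mono[OF HG] by blast
      then show "x \<in> ?R \<longleftrightarrow> y \<in> ?R"
        using graph_symmetric by (blast intro: reachable_adj_trans)
    qed
    moreover have "?R \<subseteq> verts H" using CH by (auto simp: subgraph_def)
    moreover have "arcs ?C \<subseteq> arcs H" using CH by (simp add: subgraph_def)
    moreover have "arcs H \<subseteq> arcs ?C"
      using \<open>verts H \<subseteq> ?R\<close> subgraph_induce_subgraphI2[OF HG] by (auto simp: subgraph_def)
    ultimately show ?thesis using CH
      by (intro pre_digraph.equality) (auto simp: subgraph_def compatible_def)
  qed
  then show "connected_component G ?C"
    using sub conn by (auto simp: connected_component_def max_subgraph_def)
  show "z \<in> verts ?C" using assms by simp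
qed

section \<open>Two-colourings and b-pairs\<close>

text \<open>The complement of \<open>A\<close> serves as the second class, so a colouring is a
  single set, possibly with points outside the graph.\<close>

lemma bipartite_iff_colouring:
  assumes "wf_digraph G"
  shows "bipartite G \<longleftrightarrow> (\<exists>A. \<forall>u v. (u, v) \<in> arcs_ends G \<longrightarrow> (u \<in> A \<longleftrightarrow> v \<notin> A))"
    (is "_ \<longleftrightarrow> (\<exists>A. ?colouring A)")
proof
  assume "bipartite G"
  then obtain A B where disj: "A \<inter> B = {}"
    and AB: "\<forall>(u, v) \<in> arcs_ends G. u \<in> A \<and> v \<in> B \<or> u \<in> B \<and> v \<in> A"
    unfolding bipartite_def by (elim exE conjE)
  have "u \<in> A \<longleftrightarrow> v \<notin> A" if "(u, v) \<in> arcs_ends G" for u v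
    using bspec[OF AB that] disj by auto
  then show "\<exists>A. ?colouring A" by (intro exI[of _ A]) simp
next
  assume "\<exists>A. ?colouring A"
  then obtain A where A: "?colouring A" by (rule exE)
  show "bipartite G" unfolding bipartite_def
  proof (intro exI conjI ballI)
    show "verts G = (verts G \<inter> A) \<union> (verts G - A)" "(verts G \<inter> A) \<inter> (verts G - A) = {}" by auto
    fix e assume e: "e \<in> arcs_ends G"
    obtain u v where uv: "e = (u, v)" by (cases e)
    then show "case e of (u, v) \<Rightarrow> u \<in> verts G \<inter> A \<and> v \<in> verts G - A \<or>
        u \<in> verts G - A \<and> v \<in> verts G \<inter> A"
      using A e wf_digraph.adj_in_verts[OF assms, of u v] by simp
  qed
qed

text \<open>\<open>T\<close> is the vertex set of the bipartite component. That adding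
  \<open>x\<close> keeps it bipartite is restated as a common colour \<open>s\<close> of all
  neighbours of \<open>x\<close> in \<open>T\<close>, the form that lifts to the product.\<close>

lemma b_pairE:
  assumes "graph G" and "b_pair G X Y"
  obtains (colouring) T A where "X \<subseteq> verts G" and "Y \<subseteq> verts G" and "X \<inter> Y = {}"
    and "T \<noteq> {}" and "T \<subseteq> verts G - (X \<union> Y)"
    and "\<And>u v. \<lbrakk>(u, v) \<in> arcs_ends G; u \<in> T\<rbrakk> \<Longrightarrow> v \<in> T \<union> X \<union> Y"
    and "\<And>u v. \<lbrakk>(u, v) \<in> arcs_ends G; u \<in> T; v \<in> T\<rbrakk> \<Longrightarrow> u \<in> A \<longleftrightarrow> v \<notin> A"
    and "\<And>x. x \<in> X \<Longrightarrow> \<exists>s. \<forall>u\<in>T. (x, u) \<in> arcs_ends G \<longrightarrow> (u \<in> A \<longleftrightarrow> s)"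
proof -
  interpret graph G by fact
  let ?D = "delete_verts G (X \<union> Y)"
  have isub: "induced_subgraph ?D G" unfolding delete_verts_def by (rule induced_induce) auto
  interpret D: sym_digraph ?D using isub by (rule induced_graph_imp_graph)
  have D_adj: "(u, v) \<in> arcs_ends ?D \<longleftrightarrow> (u, v) \<in> arcs_ends G \<and> u \<notin> X \<union> Y \<and> v \<notin> X \<union> Y" for u v
    using adj_in_verts[of u v] by (auto simp: delete_verts_def arcs_ends_induce_subgraph_iff)
  obtain C where C: "connected_component ?D C" "bipartite C"
    and ext: "\<And>x. x \<in> X \<Longrightarrow> bipartite (G \<restriction> (verts C \<union> {x}))"
    using assms(2) unfolding b_pair_def by blast
  have conn: "Digraph_Component.connected C" and sub: "subgraph C ?D"
    using C(1) by (auto simp: connected_component_def pre_digraph.max_subgraph_def)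
  from sub have "wf_digraph C" by blast
  with C(2) obtain A where A: "\<And>u v. (u, v) \<in> arcs_ends C \<Longrightarrow> u \<in> A \<longleftrightarrow> v \<notin> A"
    unfolding bipartite_iff_colouring[OF \<open>wf_digraph C\<close>] by blast
  have ne: "verts C \<noteq> {}" using conn by (simp add: connected_conv)
  have Csub: "verts C \<subseteq> verts G - (X \<union> Y)" using sub by (auto simp: subgraph_def)
  note Cadj = connected_component_adj[OF D.wf_digraph C(1)]
  have "\<exists>s. \<forall>u\<in>verts C. (x, u) \<in> arcs_ends G \<longrightarrow> (u \<in> A \<longleftrightarrow> s)" if x: "x \<in> X" for x
  proof -
    obtain B where "\<forall>u v. (u, v) \<in> arcs_ends (G \<restriction> (verts C \<union> {x})) \<longrightarrow> (u \<in> B \<longleftrightarrow> v \<notin> B)"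
      using ext[OF x] unfolding bipartite_iff_colouring[OF wellformed_induce_subgraph] by (rule exE)
    then have B: "u \<in> B \<longleftrightarrow> v \<notin> B"
      if "(u, v) \<in> arcs_ends G" "u \<in> insert x (verts C)" "v \<in> insert x (verts C)" for u v
      using that by (simp add: arcs_ends_induce_subgraph_iff)
    have B': "u \<in> B \<longleftrightarrow> v \<notin> B" if "(u, v) \<in> arcs_ends C" for u v
      using B that arcs_ends_mono[OF sub] D_adj wf_digraph.adj_in_verts[OF \<open>wf_digraph C\<close> that]
      by blast
    let ?E = "{u. u \<in> A \<longleftrightarrow> u \<in> B}"
    obtain w where w: "w \<in> verts C" using ne by blast
    have E: "\<And>u v. (u, v) \<in> arcs_ends C \<Longrightarrow> u \<in> ?E \<longleftrightarrow> v \<in> ?E" using A B' by blast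
    txt \<open>Two colourings of a connected graph agree everywhere or nowhere.\<close>
    have "verts C \<subseteq> ?E \<or> verts C \<subseteq> - ?E"
    proof (cases "w \<in> ?E")
      case True
      then show ?thesis using connected_adj_closed_subset[OF conn w True E] by blast
    next
      case False
      then have "verts C \<subseteq> - ?E"
        using E by (intro connected_adj_closed_subset[OF conn w]) blast+
      then show ?thesis ..
    qed
    then show ?thesis
    proof
      assume "verts C \<subseteq> ?E"
      then show ?thesis using B by (intro exI[of _ "x \<notin> B"]) blast
    next
      assume "verts C \<subseteq> - ?E"
      then show ?thesis using B by (intro exI[of _ "x \<in> B"]) blast
    qed
  qed
  moreover have "v \<in> verts C \<union> X \<union> Y" if "(u, v) \<in> arcs_ends G" "u \<in> verts C" for u v
    using Cadj[of u v] that Csub by (auto simp: D_adj)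
  moreover have "u \<in> A \<longleftrightarrow> v \<notin> A" if "(u, v) \<in> arcs_ends G" "u \<in> verts C" "v \<in> verts C" for u v
    using Cadj[of u v] that Csub by (intro A) (auto simp: D_adj)
  moreover have "X \<subseteq> verts G" "Y \<subseteq> verts G" "X \<inter> Y = {}"
    using assms(2) by (auto simp: b_pair_def)
  ultimately show thesis using ne Csub by (intro that[of "verts C" A])
qed

text \<open>A closed set \<open>T\<close> is a union of components of what remains, and the
  component of any vertex of \<open>T\<close> inherits both the colouring and the condition on
  \<open>X\<close>.\<close>

lemma b_pairI:
  assumes "graph G" and "X \<subseteq> verts G" and "Y \<subseteq> verts G" and "X \<inter> Y = {}"
    and T: "T \<noteq> {}" "T \<subseteq> verts G - (X \<union> Y)"
    and closed: "\<And>u v. \<lbrakk>(u, v) \<in> arcs_ends G; u \<in> T\<rbrakk> \<Longrightarrow> v \<in> T \<union> X \<union> Y"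
    and colour: "\<And>u v. \<lbrakk>(u, v) \<in> arcs_ends G; u \<in> T; v \<in> T\<rbrakk> \<Longrightarrow> u \<in> A \<longleftrightarrow> v \<notin> A"
    and ext: "\<And>x. x \<in> X \<Longrightarrow> \<exists>s. \<forall>u\<in>T. (x, u) \<in> arcs_ends G \<longrightarrow> (u \<in> A \<longleftrightarrow> s)"
  shows "b_pair G X Y"
proof -
  interpret graph G by fact
  let ?D = "delete_verts G (X \<union> Y)"
  have isub: "induced_subgraph ?D G" unfolding delete_verts_def by (rule induced_induce) auto
  interpret D: sym_digraph ?D using isub by (rule induced_graph_imp_graph)
  have D_adj: "(u, v) \<in> arcs_ends ?D \<longleftrightarrow> (u, v) \<in> arcs_ends G \<and> u \<notin> X \<union> Y \<and> v \<notin> X \<union> Y" for u v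
    using adj_in_verts[of u v] by (auto simp: delete_verts_def arcs_ends_induce_subgraph_iff)
  obtain z where z: "z \<in> T" using T(1) by blast
  with T(2) have zD: "z \<in> verts ?D" by auto
  from D.connected_component_exists[OF this]
  obtain C where C: "connected_component ?D C" "z \<in> verts C" .
  have conn: "Digraph_Component.connected C" and sub: "subgraph C ?D"
    using C(1) by (auto simp: connected_component_def pre_digraph.max_subgraph_def)
  from sub have wf: "wf_digraph C" by blast
  have CG: "(u, v) \<in> arcs_ends C \<Longrightarrow> (u, v) \<in> arcs_ends ?D" for u v
    using arcs_ends_mono[OF sub] by blast
  have CT: "verts C \<subseteq> T"
  proof (rule connected_adj_closed_subset[OF conn C(2) z])
    fix u v assume "(u, v) \<in> arcs_ends C"
    then have "(u, v) \<in> arcs_ends G" "(v, u) \<in> arcs_ends G" "u \<notin> X \<union> Y" "v \<notin> X \<union> Y"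
      using CG[of u v] D_adj graph_symmetric by auto
    then show "u \<in> T \<longleftrightarrow> v \<in> T" using closed[of u v] closed[of v u] by blast
  qed
  have "bipartite C" unfolding bipartite_iff_colouring[OF wf]
  proof (intro exI allI impI)
    fix u v assume uv: "(u, v) \<in> arcs_ends C"
    then have "(u, v) \<in> arcs_ends G" "u \<in> T" "v \<in> T"
      using CG[OF uv] CT D_adj wf_digraph.adj_in_verts[OF wf uv] by auto
    then show "u \<in> A \<longleftrightarrow> v \<notin> A" by (rule colour)
  qed
  moreover have "bipartite (G \<restriction> (verts C \<union> {x}))" if x: "x \<in> X" for x
  proof -
    obtain s where "\<forall>u\<in>T. (x, u) \<in> arcs_ends G \<longrightarrow> (u \<in> A \<longleftrightarrow> s)"
      using ext[OF x] by (rule exE)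
    then have s: "u \<in> A \<longleftrightarrow> s" if "u \<in> T" "(x, u) \<in> arcs_ends G" for u
      using that by simp
    \<comment> \<open>The vertex \<open>x\<close> receives the colour opposite to that of its
      neighbours; as \<open>x\<close> lies outside \<open>T\<close>, the colouring of
      \<open>T\<close> is unchanged.\<close>
    let ?A = "if s then A - {x} else insert x A"
    have "u \<in> ?A \<longleftrightarrow> v \<notin> ?A"
      if uv: "(u, v) \<in> arcs_ends G" "u \<in> verts C \<union> {x}" "v \<in> verts C \<union> {x}" for u v
    proof -
      have "u \<noteq> v" using uv adj_not_same by blast
      moreover have "x \<notin> T" using T(2) x by blast
      moreover have "(v, u) \<in> arcs_ends G" using uv graph_symmetric by blast
      moreover have "u \<in> T \<Longrightarrow> v \<in> T \<Longrightarrow> u \<in> A \<longleftrightarrow> v \<notin> A" using colour uv by blast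
      ultimately show ?thesis using s[of u] s[of v] uv CT by auto
    qed
    then show ?thesis
      unfolding bipartite_iff_colouring[OF wellformed_induce_subgraph] arcs_ends_induce_subgraph_iff
      by (intro exI[of _ ?A]) (auto simp: arcs_ends_induce_subgraph_iff)
  qed
  ultimately show "b_pair G X Y"
    using assms(2-4) C(1) zD unfolding b_pair_def by auto
qed

section \<open>Bounds for the two invariants\<close>

lemma b_number_le:
  assumes "graph G" and "b_pair G X Y"
  shows "b_number G \<le> card X + 2 * card Y"
proof -
  have "verts G \<noteq> {}" using assms(2) by (auto simp: b_pair_def)
  then show ?thesis
    unfolding b_number_def using assms b_number_wf(1)[of G] by (intro Min_le) auto
qed

lemma b_number_attained:
  assumes "graph G" and "verts G \<noteq> {}"
  obtains X Y where "b_pair G X Y" and "b_number G = card X + 2 * card Y"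
  using Min_in[OF b_number_wf[OF assms]] unfolding b_number_def by blast

text \<open>Deleting its neighbours isolates \<open>v\<close>. The component \<open>{v}\<close> has
  one vertex, so the neighbours of any deleted vertex in it trivially share a colour.\<close>

lemma b_number_le_degree:
  assumes "graph G" and "v \<in> verts G"
  shows "b_number G \<le> card {w. (v, w) \<in> arcs_ends G}"
proof -
  interpret graph G by fact
  let ?N = "{w. (v, w) \<in> arcs_ends G}"
  have "?N \<subseteq> verts G" "v \<notin> ?N" using adj_in_verts adj_not_same by blast+
  then have "b_pair G ?N {}"
    using assms by (intro b_pairI[where T = "{v}" and A = "{v}"]) auto
  from b_number_le[OF assms(1) this] show ?thesis by simp
qed

text \<open>Off \<open>S\<close>, membership in \<open>A\<close> is constant along arcs, so
  \<open>A\<close> splits the remaining vertices into two nonempty parts with no arcs between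
  them.\<close>

lemma vertex_connectivity_le_separator:
  assumes "wf_digraph G" and "finite (verts G)" and "S \<subseteq> verts G"
    and a: "a \<in> verts G - S" "a \<in> A" and b: "b \<in> verts G - S" "b \<notin> A"
    and closed: "\<And>u v. \<lbrakk>(u, v) \<in> arcs_ends G; u \<notin> S; v \<notin> S\<rbrakk> \<Longrightarrow> u \<in> A \<longleftrightarrow> v \<in> A"
  shows "vertex_connectivity G \<le> card S"
proof -
  interpret wf_digraph G by fact
  interpret D: wf_digraph "delete_verts G S" unfolding delete_verts_def ..
  have "\<not> Digraph_Component.connected (delete_verts G S)"
    using a b closed connected_adj_closed_subset[of "delete_verts G S" a A]
    by (auto simp: delete_verts_def arcs_ends_induce_subgraph_iff)
  moreover have "S \<subset> verts G" "verts G \<noteq> {}" using a assms(3) by auto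
  ultimately show ?thesis
    unfolding vertex_connectivity_def using vertex_connectivity_wf(1)[OF assms(2)]
    by (intro Min_le) auto
qed

text \<open>Strict because only proper subsets may be removed. This settles the case in which the
  product is reduced to one vertex.\<close>

lemma vertex_connectivity_less_card:
  assumes "finite (verts G)" and "verts G \<noteq> {}"
  shows "vertex_connectivity G < card (verts G)"
proof -
  obtain S where "S \<subset> verts G" "vertex_connectivity G = card S"
    using Min_in[OF vertex_connectivity_wf[OF assms]] unfolding vertex_connectivity_def by auto
  then show ?thesis using assms(1) by (simp add: psubset_card_mono)
qed

text \<open>When a minimum cut leaves more than one vertex, the failure of connectedness supplies a
  closed set \<open>A\<close> that splits the rest.\<close>

lemma vertex_connectivity_cases:
  assumes "wf_digraph G" and "finite (verts G)" and "verts G \<noteq> {}"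
  obtains (trivial) S where "S \<subset> verts G" and "vertex_connectivity G = card S"
      and "card (verts G - S) = 1"
  | (separator) S A a b where "S \<subset> verts G" and "vertex_connectivity G = card S"
      and "a \<in> verts G - S" and "a \<in> A" and "b \<in> verts G - S" and "b \<notin> A"
      and "\<And>u v. \<lbrakk>(u, v) \<in> arcs_ends G; u \<notin> S; v \<notin> S\<rbrakk> \<Longrightarrow> u \<in> A \<longleftrightarrow> v \<in> A"
proof -
  interpret wf_digraph G by fact
  obtain S where S: "S \<subset> verts G" "vertex_connectivity G = card S"
    and S': "\<not> Digraph_Component.connected (delete_verts G S) \<or> card (verts G - S) = 1"
    using Min_in[OF vertex_connectivity_wf[OF assms(2,3)]] unfolding vertex_connectivity_def by auto
  show thesis
  proof (cases "card (verts G - S) = 1")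
    case True
    then show thesis using trivial S by blast
  next
    case False
    interpret D: wf_digraph "delete_verts G S" unfolding delete_verts_def ..
    have "verts (delete_verts G S) \<noteq> {}" using S by auto
    then obtain A where "(verts G - S) \<inter> A \<noteq> {}" "\<not> verts G - S \<subseteq> A"
      and A: "\<And>u v. (u, v) \<in> arcs_ends (delete_verts G S) \<Longrightarrow> u \<in> A \<longleftrightarrow> v \<in> A"
      using False S' unfolding D.connected_iff_adj_closed by auto
    then obtain a b where ab: "a \<in> verts G - S" "a \<in> A" "b \<in> verts G - S" "b \<notin> A" by blast
    have "u \<in> A \<longleftrightarrow> v \<in> A" if "(u, v) \<in> arcs_ends G" "u \<notin> S" "v \<notin> S" for u v
      using A[of u v] that adj_in_verts[OF that(1)]
      by (auto simp: delete_verts_def arcs_ends_induce_subgraph_iff)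
    then show thesis using separator S ab by blast
  qed
qed

section \<open>The product with \<open>K_2\<close>, whose vertices are named \<open>p\<close> and
  \<open>q\<close>\<close>

lemma complete_digraph_2E:
  assumes "complete_digraph 2 K"
  obtains p q where "p \<noteq> q" and "verts K = {p, q}" and "arcs_ends K = {(p, q), (q, p)}"
proof -
  obtain p q where pq: "verts K = {p, q}" "p \<noteq> q"
    using assms by (auto simp: complete_digraph_def card_2_iff)
  moreover have "arcs_ends K = {(p, q), (q, p)}"
    using assms pq by (auto simp: complete_digraph_def)
  ultimately show thesis using that by blast
qed

lemma verts_kronecker_product [simp]: "verts (kronecker_product G H) = verts G \<times> verts H"
  by (simp add: kronecker_product_def)

context
  fixes G :: "('a, 'b) pre_digraph" and K :: "('c, 'd) pre_digraph" and p q :: 'c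
  assumes G: "graph G" and G_ne: "verts G \<noteq> {}"
    and K: "graph K" "p \<noteq> q" "verts K = {p, q}" "arcs_ends K = {(p, q), (q, p)}"
begin

interpretation G: graph G by (fact G)
interpretation GK: graph "kronecker_product G K" by (intro graph_kronecker_product G K)

lemma vertex_connectivity_double_le:
  "vertex_connectivity (kronecker_product G K) \<le> 2 * vertex_connectivity G"
  using G.wf_digraph G.finite_verts G_ne
proof (cases rule: vertex_connectivity_cases)
  case (trivial S)
  then obtain v where v: "verts G - S = {v}" by (auto simp: card_1_singleton_iff)
  \<comment> \<open>The two copies of the one remaining vertex \<open>v\<close> are not adjacent, as
    \<open>G\<close> has no loops, so they are separated from each other.\<close>
  have "vertex_connectivity (kronecker_product G K) \<le> card (S \<times> {p, q})"
  proof (rule vertex_connectivity_le_separator)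
    show "(v, p) \<in> verts (kronecker_product G K) - S \<times> {p, q}" "(v, p) \<in> {(v, p)}"
      "(v, q) \<in> verts (kronecker_product G K) - S \<times> {p, q}" "(v, q) \<notin> {(v, p)}"
      using v K by auto
    fix e f assume "(e, f) \<in> arcs_ends (kronecker_product G K)" "e \<notin> S \<times> {p, q}" "f \<notin> S \<times> {p, q}"
    moreover from this have "fst e \<in> verts G - S" "fst f \<in> verts G - S"
      using GK.adj_in_verts[of e f] K(3) by auto
    ultimately show "e \<in> {(v, p)} \<longleftrightarrow> f \<in> {(v, p)}"
      using G.adj_not_same by (cases e, cases f) (auto simp: v arcs_ends_kronecker_product)
  qed (use trivial K GK.wf_digraph in auto)
  then show ?thesis using trivial K by (simp add: card_cartesian_product)
next
  case (separator S A a b)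
  have "vertex_connectivity (kronecker_product G K) \<le> card (S \<times> {p, q})"
  proof (rule vertex_connectivity_le_separator)
    show "(a, p) \<in> verts (kronecker_product G K) - S \<times> {p, q}" "(a, p) \<in> A \<times> {p, q}"
      "(b, p) \<in> verts (kronecker_product G K) - S \<times> {p, q}" "(b, p) \<notin> A \<times> {p, q}"
      using separator(3-6) K by auto
    fix e f assume "(e, f) \<in> arcs_ends (kronecker_product G K)" "e \<notin> S \<times> {p, q}" "f \<notin> S \<times> {p, q}"
    then show "e \<in> A \<times> {p, q} \<longleftrightarrow> f \<in> A \<times> {p, q}"
      using separator(7)[of "fst e" "fst f"]
      by (cases e, cases f) (auto simp: arcs_ends_kronecker_product K)
  qed (use separator K GK.wf_digraph in auto)
  then show ?thesis using separator K by (simp add: card_cartesian_product)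
qed

lemma vertex_connectivity_double_le_b_number:
  "vertex_connectivity (kronecker_product G K) \<le> b_number G"
proof -
  obtain X Y where bp: "b_pair G X Y" and b: "b_number G = card X + 2 * card Y"
    using b_number_attained[OF G G_ne] .
  from G bp show ?thesis
  proof (cases rule: b_pairE)
    case (colouring T A)
    note XY = colouring(1-3) and T = colouring(4,5) and cl = colouring(6) and A = colouring(7)
    have "\<forall>x\<in>X. \<exists>s. \<forall>u\<in>T. (x, u) \<in> arcs_ends G \<longrightarrow> (u \<in> A \<longleftrightarrow> s)"
      using colouring(8) by (rule ballI)
    then obtain s where "\<forall>x\<in>X. \<forall>u\<in>T. (x, u) \<in> arcs_ends G \<longrightarrow> (u \<in> A \<longleftrightarrow> s x)"
      by (rule bchoice[THEN exE])
    then have s: "u \<in> A \<longleftrightarrow> s x" if "x \<in> X" "u \<in> T" "(x, u) \<in> arcs_ends G" for x u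
      using that by simp
    \<comment> \<open>If the neighbours of \<open>x\<close> in \<open>T\<close> lie in
      \<open>A\<close>, their copies in \<open>D\<close> sit at \<open>p\<close> and reach only
      \<open>(x, q)\<close>; otherwise they sit at \<open>q\<close> and reach only
      \<open>(x, p)\<close>. The copy reached is the one removed.\<close>
    let ?f = "\<lambda>x. (x, if s x then q else p)"
    define S where "S = ?f ` X \<union> Y \<times> {p, q}"
    define D where "D = (T \<inter> A) \<times> {p} \<union> (T - A) \<times> {q}"
    \<comment> \<open>Showing that \<open>D\<close> cannot be left is enough: arcs are symmetric, so
      it cannot be entered either.\<close>
    have step: "f \<in> D" if ef: "(e, f) \<in> arcs_ends (kronecker_product G K)" "f \<notin> S" "e \<in> D" for e f
    proof -
      obtain u i v j where e: "e = (u, i)" "f = (v, j)" by (cases e, cases f)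
      have uv: "(u, v) \<in> arcs_ends G" "(v, u) \<in> arcs_ends G" "i = p \<and> j = q \<or> i = q \<and> j = p"
        using ef(1) G.graph_symmetric by (auto simp: e arcs_ends_kronecker_product K)
      have u: "u \<in> T" using ef(3) by (auto simp: e D_def)
      have "v \<notin> Y" using ef(2) uv(3) by (auto simp: e S_def)
      moreover have "v \<notin> X"
      proof
        assume "v \<in> X"
        then have "u \<in> A \<longleftrightarrow> s v" using s u uv by blast
        with \<open>v \<in> X\<close> ef(2,3) uv(3) K(2) show False by (auto simp: e S_def D_def split: if_splits)
      qed
      ultimately have "v \<in> T" using cl u uv by blast
      moreover from this have "u \<in> A \<longleftrightarrow> v \<notin> A" using A u uv by blast
      ultimately show ?thesis using ef(3) uv(3) K(2) by (auto simp: e D_def)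
    qed
    obtain z where z: "z \<in> T" using T by blast
    have nS: "(z, i) \<notin> S" for i using z T by (auto simp: S_def)
    have "vertex_connectivity (kronecker_product G K) \<le> card S"
    proof (rule vertex_connectivity_le_separator)
      \<comment> \<open>Each vertex of \<open>T\<close> has one copy in \<open>D\<close> and one
        outside, so \<open>S\<close> separates the two copies of \<open>z\<close>.\<close>
      let ?a = "(z, if z \<in> A then p else q)" and ?b = "(z, if z \<in> A then q else p)"
      show "?a \<in> verts (kronecker_product G K) - S" "?b \<in> verts (kronecker_product G K) - S"
        "?a \<in> D" "?b \<notin> D"
        using z T nS K by (auto simp: D_def)
      have "?f x \<in> verts G \<times> {p, q}" if "x \<in> X" for x
        using that XY(1) by (simp add: subsetD)
      moreover have "Y \<times> {p, q} \<subseteq> verts G \<times> {p, q}" using XY(2) by (rule Sigma_mono) simp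
      ultimately show "S \<subseteq> verts (kronecker_product G K)"
        unfolding S_def verts_kronecker_product K(3) by (intro Un_least image_subsetI)
      show "e \<in> D \<longleftrightarrow> f \<in> D"
        if "(e, f) \<in> arcs_ends (kronecker_product G K)" "e \<notin> S" "f \<notin> S" for e f
        using step[of e f] step[of f e] that GK.graph_symmetric[of e f] by argo
    qed (use GK.wf_digraph GK.finite_verts in auto)
    also have "card S \<le> card X + 2 * card Y"
    proof -
      have "finite X" using XY(1) G.finite_verts by (rule finite_subset)
      then have "card (?f ` X) \<le> card X" by (rule card_image_le)
      moreover have "card (Y \<times> {p, q}) = 2 * card Y" using K(2) by (simp add: card_cartesian_product)
      ultimately show ?thesis unfolding S_def using card_Un_le[of "?f ` X" "Y \<times> {p, q}"] by linarith
    qed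
    finally show ?thesis using b by simp
  qed
qed

lemma min_le_vertex_connectivity_double:
  "min (2 * vertex_connectivity G) (b_number G) \<le> vertex_connectivity (kronecker_product G K)"
proof -
  have "verts (kronecker_product G K) \<noteq> {}" using G_ne K by auto
  with GK.wf_digraph GK.finite_verts show ?thesis
  proof (cases rule: vertex_connectivity_cases)
    case (trivial S)
    have "card (verts (kronecker_product G K) - S) = card (verts (kronecker_product G K)) - card S"
      using trivial GK.finite_verts by (intro card_Diff_subset) (auto intro: finite_subset)
    \<comment> \<open>All but one of the \<open>2 * card (verts G)\<close> vertices are removed,
      while the connectivity of \<open>G\<close> is at most
      \<open>card (verts G) - 1\<close>.\<close>
    with trivial(3) have "card S + 1 = 2 * card (verts G)"
      using K by (simp add: card_cartesian_product)
    then show ?thesis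
      using vertex_connectivity_less_card[OF G.finite_verts G_ne] trivial(2) by simp
  next
    case (separator S D a b)
    define X where "X = {x \<in> verts G. (x, p) \<in> S \<longleftrightarrow> (x, q) \<notin> S}"
    define Y where "Y = {x \<in> verts G. (x, p) \<in> S \<and> (x, q) \<in> S}"
    define Z where "Z = verts G - (X \<union> Y)"
    have fin: "finite X" "finite Y" "X \<inter> Y = {}" by (auto simp: X_def Y_def)
    have Z: "(z, i) \<notin> S" if "z \<in> Z" for z i
      using that separator(1) K by (cases "i \<in> {p, q}") (auto simp: Z_def X_def Y_def)
    have card_S: "card S = card X + 2 * card Y"
    proof -
      let ?g = "\<lambda>x. (x, if (x, p) \<in> S then p else q)"
      have "S = ?g ` X \<union> Y \<times> {p, q}"
        using separator(1) K by (auto simp: X_def Y_def image_iff split: if_splits)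
      moreover have "card (?g ` X) = card X" by (intro card_image inj_onI) simp
      moreover have "?g ` X \<inter> Y \<times> {p, q} = {}" using fin by auto
      ultimately show ?thesis using fin K(2) by (subst \<open>S = _\<close>, subst card_Un_disjoint) (auto simp: card_cartesian_product)
    qed
    have sep: "(u, i) \<in> D \<longleftrightarrow> (v, j) \<in> D"
      if "(u, v) \<in> arcs_ends G" "(u, i) \<notin> S" "(v, j) \<notin> S" "i = p \<and> j = q \<or> i = q \<and> j = p" for u v i j
      using that by (intro separator(7)) (auto simp: arcs_ends_kronecker_product K)
    show ?thesis
    proof (cases "\<exists>z\<in>Z. (z, p) \<in> D \<longleftrightarrow> (z, q) \<notin> D")
      case True
      let ?T = "{z \<in> Z. (z, p) \<in> D \<longleftrightarrow> (z, q) \<notin> D}" and ?A = "{z. (z, p) \<in> D}"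
      \<comment> \<open>For \<open>v\<close> in \<open>Z\<close>, \<open>(v, q)\<close> is on the
        side of \<open>(u, p)\<close> and \<open>(v, p)\<close> on the side of
        \<open>(u, q)\<close>, so the copies of \<open>v\<close> are split as well.\<close>
      have "v \<in> ?T \<union> X \<union> Y" if "(u, v) \<in> arcs_ends G" "u \<in> ?T" for u v
      proof (cases "v \<in> Z")
        case True
        then show ?thesis using sep[of u v p q] sep[of u v q p] Z that by auto
      next
        case False
        then show ?thesis using G.adj_in_verts(2)[OF that(1)] by (auto simp: Z_def)
      qed
      moreover have "u \<in> ?A \<longleftrightarrow> v \<notin> ?A" if "(u, v) \<in> arcs_ends G" "u \<in> ?T" "v \<in> ?T" for u v
        using sep[of u v p q] Z that by auto
      \<comment> \<open>The remaining copy of \<open>x\<close> fixes the side of the opposite copy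
        of every neighbour. If that copy is \<open>(x, q)\<close>, it gives the colour directly; if
        it is \<open>(x, p)\<close>, it gives the side of \<open>(u, q)\<close>, whence the
        negation.\<close>
      moreover have "\<exists>s. \<forall>u\<in>?T. (x, u) \<in> arcs_ends G \<longrightarrow> (u \<in> ?A \<longleftrightarrow> s)" if "x \<in> X" for x
      proof (cases "(x, p) \<in> S")
        case True
        with that have "(x, q) \<notin> S" by (auto simp: X_def)
        then show ?thesis using sep[of x _ q p] Z by (intro exI[of _ "(x, q) \<in> D"]) auto
      next
        case False
        then show ?thesis using sep[of x _ p q] Z by (intro exI[of _ "(x, p) \<notin> D"]) auto
      qed
      moreover have "?T \<noteq> {}" "?T \<subseteq> verts G - (X \<union> Y)" "X \<subseteq> verts G" "Y \<subseteq> verts G"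
        using True by (auto simp: Z_def X_def Y_def)
      ultimately have "b_pair G X Y"
        using fin(3) by (intro b_pairI[OF G, where T = ?T and A = ?A])
      from b_number_le[OF G this] show ?thesis using separator(2) card_S by simp
    next
      case False
      then have uniform: "z \<in> Z \<Longrightarrow> (z, p) \<in> D \<longleftrightarrow> (z, q) \<in> D" for z by blast
      show ?thesis
      proof (cases "\<exists>x\<in>verts G. {w. (x, w) \<in> arcs_ends G} \<subseteq> X \<union> Y")
        case True
        then obtain x where x: "x \<in> verts G" "{w. (x, w) \<in> arcs_ends G} \<subseteq> X \<union> Y" by blast
        have "b_number G \<le> card {w. (x, w) \<in> arcs_ends G}" using b_number_le_degree[OF G x(1)] .
        also have "\<dots> \<le> card (X \<union> Y)" using x(2) fin by (intro card_mono) auto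
        also have "\<dots> \<le> card S" using card_Un_le[of X Y] card_S by linarith
        finally show ?thesis using separator(2) by simp
      next
        case False
        \<comment> \<open>Every vertex of \<open>G\<close> now has a neighbour in \<open>Z\<close>,
          and both copies of that neighbour lie on one side, so each remaining vertex of the product
          shares its side with some member of \<open>Z\<close>. Applied to \<open>a\<close> and
          \<open>b\<close>, this gives \<open>z1\<close> and \<open>z2\<close>.\<close>
        have rep: "\<exists>z\<in>Z. (z, p) \<in> D \<longleftrightarrow> c \<in> D" if c: "c \<in> verts (kronecker_product G K) - S" for c
        proof -
          obtain v i where vi: "c = (v, i)" "v \<in> verts G" "i = p \<or> i = q" using c K by auto
          then obtain w where w: "(v, w) \<in> arcs_ends G" "w \<in> Z"
            using False G.adj_in_verts(2) by (fastforce simp: Z_def)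
          then show ?thesis
            using vi c K(2) sep[of v w i "if i = p then q else p"] Z[OF w(2)] uniform[OF w(2)]
            by (intro bexI[of _ w]) (auto split: if_splits)
        qed
        obtain z1 z2 where z1: "z1 \<in> Z" "(z1, p) \<in> D" and z2: "z2 \<in> Z" "(z2, p) \<notin> D"
          using rep[of a] rep[of b] separator(3-6) by blast
        \<comment> \<open>The Boolean \<open>c\<close> names a side, so that one argument yields
          both separators of \<open>G\<close>.\<close>
        define X' where "X' c = {x \<in> X. \<exists>i\<in>{p, q}. (x, i) \<notin> S \<and> ((x, i) \<in> D \<longleftrightarrow> c)}" for c
        define Z' where "Z' c = {z \<in> Z. (z, p) \<in> D \<longleftrightarrow> c}" for c
        \<comment> \<open>Both copies of \<open>u\<close> lie on side \<open>c\<close>, and any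
          remaining copy of \<open>v\<close> is adjacent to one of them. Hence \<open>v\<close> lies
          on side \<open>c\<close> too, and belongs to \<open>X' c\<close> if it is in
          \<open>X\<close>.\<close>
        have stay: "v \<in> Z' c" if uv: "(u, v) \<in> arcs_ends G" "v \<notin> X' c \<union> Y" "u \<in> Z' c" for u v c
        proof -
          have u: "u \<in> Z" "(u, p) \<in> D \<longleftrightarrow> c" "(u, q) \<in> D \<longleftrightarrow> c"
            using uv(3) uniform by (auto simp: Z'_def)
          have "v \<notin> X"
          proof
            assume v: "v \<in> X"
            then consider "(v, p) \<notin> S" | "(v, q) \<notin> S" by (auto simp: X_def)
            then have "v \<in> X' c"
            proof cases
              case 1
              then have "(v, p) \<in> D \<longleftrightarrow> c" using sep[of u v q p] uv(1) Z u by simp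
              then show ?thesis using 1 v by (simp add: X'_def)
            next
              case 2
              then have "(v, q) \<in> D \<longleftrightarrow> c" using sep[of u v p q] uv(1) Z u by simp
              then show ?thesis using 2 v by (simp add: X'_def)
            qed
            then show False using uv(2) by simp
          qed
          then have "v \<in> Z" using uv(1,2) G.adj_in_verts(2) by (simp add: Z_def)
          moreover have "(v, p) \<in> D \<longleftrightarrow> c" using sep[of u v q p] uv(1) Z \<open>v \<in> Z\<close> u by simp
          ultimately show ?thesis by (simp add: Z'_def)
        qed
        have X'_sub: "X' c \<subseteq> X" for c by (auto simp: X'_def)
        have le: "vertex_connectivity G \<le> card (X' c) + card Y"
          if z: "z \<in> Z' c" "w \<in> Z' (\<not> c)" for c z w
        proof -
          have "vertex_connectivity G \<le> card (X' c \<union> Y)"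
          proof (rule vertex_connectivity_le_separator)
            show "z \<in> Z' c" "w \<notin> Z' c" "z \<in> verts G - (X' c \<union> Y)" "w \<in> verts G - (X' c \<union> Y)"
              using z X'_sub by (auto simp: Z'_def Z_def)
            show "X' c \<union> Y \<subseteq> verts G" by (auto simp: X'_def X_def Y_def)
            show "u \<in> Z' c \<longleftrightarrow> v \<in> Z' c"
              if "(u, v) \<in> arcs_ends G" "u \<notin> X' c \<union> Y" "v \<notin> X' c \<union> Y" for u v
              using stay[of u v c] stay[of v u c] that G.graph_symmetric[of u v] by argo
          qed (use G.wf_digraph in auto)
          then show ?thesis using card_Un_le le_trans by blast
        qed
        have "vertex_connectivity G \<le> card (X' True) + card Y"
          using z1 z2 by (intro le[of z1 _ z2]) (auto simp: Z'_def)
        moreover have "vertex_connectivity G \<le> card (X' False) + card Y"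
          using z1 z2 by (intro le[of z2 _ z1]) (auto simp: Z'_def)
        \<comment> \<open>A vertex of \<open>X\<close> has exactly one remaining copy, which lies on
          one side only, while \<open>Y\<close> is counted in both separators, matching its weight
          2.\<close>
        moreover have "card (X' True) + card (X' False) \<le> card X"
        proof -
          have "X' True \<inter> X' False = {}" by (auto simp: X'_def X_def)
          then have "card (X' True) + card (X' False) = card (X' True \<union> X' False)"
            using fin(1) X'_sub by (metis card_Un_disjoint finite_subset)
          also have "\<dots> \<le> card X" using fin(1) X'_sub by (intro card_mono) auto
          finally show ?thesis .
        qed
        ultimately have "2 * vertex_connectivity G \<le> card S"
          using card_S by linarith
        then show ?thesis using separator(2) by simp
      qed
    qed
  qed
qed

end

theorem theorem1p1:
  fixes G :: "('a, 'b) pre_digraph" and K :: "('c, 'd) pre_digraph"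
  assumes "graph G" and "verts G \<noteq> {}"
    and "complete_digraph 2 K"
  shows "vertex_connectivity (kronecker_product G K) =
    min (2 * vertex_connectivity G) (b_number G)"
proof -
  have K: "graph K" using assms(3) by (simp add: complete_digraph_def)
  obtain p q where pq: "p \<noteq> q" "verts K = {p, q}" "arcs_ends K = {(p, q), (q, p)}"
    using assms(3) by (rule complete_digraph_2E)
  note G_K = assms(1,2) K pq
  show ?thesis
    using vertex_connectivity_double_le[OF G_K] vertex_connectivity_double_le_b_number[OF G_K]
      min_le_vertex_connectivity_double[OF G_K] by simp
qed

end
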